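(* There is a 3-round MPC algorithm that, given a $d$-uniform hypergraph $G$ with $n$ vertices and $m$ hyperedges, computes with high probability a subgraph of $G$ containing a matching that is a $\left(d-1+\frac1d\right)^2$-approximation of the maximum matching of $G$, using $\tilde O(\sqrt{nm})$ space per machine if $G$ is linear, and $\tilde O(n\sqrt{nm})$ space per machine in general.
   Context: A hypergraph is $d$-uniform if every hyperedge is a set of exactly $d$ vertices, and linear if any two distinct hyperedges share at most one vertex. A matching is a set of pairwise disjoint hyperedges; $\mu(G)$ is the maximum cardinality of a matching. A matching $M$ is a $\rho$-approximation if $\rho|M|\ge\mu(G)$. MPC (Massively Parallel Computation) model: an input of size $N$ is distributed over $k$ machines, each with space $s$, where $k\cdot s=\tilde O(N)$ ($\tilde O$ hides polylogarithmic factors). The number of machines and the memory per machine are required to be substantially sublinear in the input size. Computation proceeds in synchronous rounds. In each round every machine performs arbitrary local computation on its data (of size at most $s$; there is no restriction on computational power) and then sends messages; the total communication sent or received by a machine in a round is at most $s$. The received messages are its input for the next round. The computed subgraph is stored on a single machine. "With high probability" means with probability $1-o(1)$ as $n\to\infty$. *)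

theory Defs
  imports "HOL-Probability.Probability"
begin

section \<open>Hypergraphs and matchings\<close>

text \<open>A hypergraph on a vertex set is given by its set of hyperedges.\<close>

definition uniform_hypergraph :: "nat \<Rightarrow> 'a set \<Rightarrow> 'a set set \<Rightarrow> bool" where
  "uniform_hypergraph d V E \<longleftrightarrow> finite V \<and> (\<forall>e\<in>E. e \<subseteq> V \<and> card e = d)"

definition linear_hypergraph :: "'a set set \<Rightarrow> bool" where
  "linear_hypergraph E \<longleftrightarrow> (\<forall>e\<in>E. \<forall>f\<in>E. e \<noteq> f \<longrightarrow> card (e \<inter> f) \<le> 1)"

definition matching :: "'a set set \<Rightarrow> 'a set set \<Rightarrow> bool" where
  "matching E M \<longleftrightarrow> M \<subseteq> E \<and> pairwise disjnt M"

definition matching_number :: "'a set set \<Rightarrow> nat" where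
  "matching_number E = Max (card ` {M. matching E M})"

definition approx_matching :: "real \<Rightarrow> 'a set set \<Rightarrow> 'a set set \<Rightarrow> bool" where
  "approx_matching \<rho> E M \<longleftrightarrow> matching E M \<and> \<rho> * real (card M) \<ge> real (matching_number E)"


section \<open>The MPC model\<close>

text \<open>
  Data are lists of words. For inputs on the vertex set \<open>{..<n}\<close> a word is a number below \<open>n\<close>,
  i.e. it has about \<open>log n\<close> bits, and space and communication are counted in words.
  A traffic matrix \<open>T\<close> records the messages of one round: \<open>T i j\<close> is what machine \<open>i\<close> sends to
  machine \<open>j\<close>; the machines are \<open>0, \<dots>, k - 1\<close>.
\<close>

type_synonym word_list = "nat list"
type_synonym traffic = "nat \<Rightarrow> nat \<Rightarrow> word_list"

text \<open>
  A protocol maps the round number, the name of the machine and the machine's inbox (indexed by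
  the sender) to a random outbox (indexed by the recipient). Machines have no other state: to
  remember something, a machine sends it to itself, so that it is charged as communication.
\<close>

type_synonym protocol = "nat \<Rightarrow> nat \<Rightarrow> (nat \<Rightarrow> word_list) \<Rightarrow> (nat \<Rightarrow> word_list) pmf"

text \<open>The machines use independent private randomness.\<close>

definition mpc_round :: "nat \<Rightarrow> protocol \<Rightarrow> nat \<Rightarrow> traffic \<Rightarrow> traffic pmf" where
  "mpc_round k A r T = Pi_pmf {..<k} (\<lambda>_. []) (\<lambda>i. A r i (\<lambda>j. T j i))"

text \<open>The traffic matrices of the first \<open>R\<close> rounds, the latest first and the initial one last.\<close>

primrec mpc_run :: "nat \<Rightarrow> protocol \<Rightarrow> traffic \<Rightarrow> nat \<Rightarrow> traffic list pmf" where
  "mpc_run k A T\<^sub>0 0 = return_pmf [T\<^sub>0]"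
| "mpc_run k A T\<^sub>0 (Suc R) =
     bind_pmf (mpc_run k A T\<^sub>0 R) (\<lambda>Ts. map_pmf (\<lambda>T. T # Ts) (mpc_round k A R (hd Ts)))"

definition within_limits :: "nat \<Rightarrow> nat \<Rightarrow> nat \<Rightarrow> traffic \<Rightarrow> bool" where
  "within_limits n k s T \<longleftrightarrow>
     (\<forall>i<k. (\<Sum>j<k. length (T i j)) \<le> s \<and> (\<Sum>j<k. length (T j i)) \<le> s) \<and>
     (\<forall>i<k. \<forall>j<k. set (T i j) \<subseteq> {..<n})"

text \<open>A hyperedge of size \<open>d\<close> takes \<open>d\<close> words, so the input size is \<open>d * m\<close>.\<close>

definition encode_edges :: "nat set list \<Rightarrow> word_list" where
  "encode_edges es = concat (map sorted_list_of_set es)"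

definition input_size :: "nat \<Rightarrow> nat \<Rightarrow> nat" where
  "input_size d m = d * m"

text \<open>A distribution of the hyperedges over \<open>k\<close> machines of space \<open>s\<close>.\<close>

definition placement :: "nat \<Rightarrow> nat \<Rightarrow> nat set set \<Rightarrow> (nat \<Rightarrow> nat set list) \<Rightarrow> bool" where
  "placement k s E P \<longleftrightarrow>
     (\<forall>i<k. distinct (P i) \<and> length (encode_edges (P i)) \<le> s) \<and>
     disjoint_family_on (\<lambda>i. set (P i)) {..<k} \<and>
     (\<Union>i<k. set (P i)) = E"

definition initial_traffic :: "nat \<Rightarrow> (nat \<Rightarrow> nat set list) \<Rightarrow> traffic" where
  "initial_traffic k P = (\<lambda>i j. if i = j \<and> i < k then encode_edges (P i) else [])"

text \<open>After the round with traffic \<open>T\<close>, the memory of machine \<open>j\<close> is exactly the hypergraph \<open>H\<close>.\<close>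

definition stores :: "nat \<Rightarrow> traffic \<Rightarrow> nat \<Rightarrow> nat set set \<Rightarrow> bool" where
  "stores k T j H \<longleftrightarrow>
     j < k \<and> (\<exists>es. set es = H \<and> concat (map (\<lambda>i. T i j) [0..<k]) = encode_edges es)"

text \<open>
  A run is successful if it never exceeds the space and communication limits and machine \<open>0\<close>
  finally stores a subgraph containing a \<open>\<rho>\<close>-approximation of the maximum matching.
\<close>

definition successful :: "real \<Rightarrow> nat \<Rightarrow> nat \<Rightarrow> nat \<Rightarrow> nat set set \<Rightarrow> traffic list \<Rightarrow> bool" where
  "successful \<rho> n k s E Ts \<longleftrightarrow>
     (\<forall>T\<in>set Ts. within_limits n k s T) \<and>
     (\<exists>H\<subseteq>E. stores k (hd Ts) 0 H \<and> (\<exists>M\<subseteq>H. approx_matching \<rho> E M))"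

text \<open>
  Success with probability \<open>1 - o(1)\<close> as \<open>n\<close> tends to infinity, uniformly over all hypergraphs in
  the class \<open>\<G> n\<close> (on the vertex set \<open>{..<n}\<close>) and over all initial distributions of the
  hyperedges. \<open>K n m\<close> is the number of machines and \<open>S n m\<close> the space per machine; the input has
  to fit into the machines in at least one way.
\<close>

definition succeeds_whp ::
    "nat \<Rightarrow> real \<Rightarrow> (nat \<Rightarrow> nat set set set) \<Rightarrow> (nat \<Rightarrow> nat \<Rightarrow> nat) \<Rightarrow> (nat \<Rightarrow> nat \<Rightarrow> nat) \<Rightarrow>
     (nat \<Rightarrow> nat \<Rightarrow> nat \<Rightarrow> nat \<Rightarrow> protocol) \<Rightarrow> bool" where
  "succeeds_whp R \<rho> \<G> K S A \<longleftrightarrow>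
     (\<exists>\<delta> :: nat \<Rightarrow> real. \<delta> \<longlonglongrightarrow> 0 \<and>
       (\<forall>n. \<forall>E\<in>\<G> n. let m = card E; k = K n m; s = S n m in
          (\<exists>P. placement k s E P) \<and>
          (\<forall>P. placement k s E P \<longrightarrow>
             measure_pmf.prob (mpc_run k (A n m k s) (initial_traffic k P) R)
               {Ts. successful \<rho> n k s E Ts} \<ge> 1 - \<delta> n)))"


section \<open>Asymptotic resource bounds\<close>

text \<open>
  Soft-O for functions of \<open>n\<close> and \<open>m\<close>. For \<open>d\<close>-uniform hypergraphs \<open>m \<le> n ^ d\<close>, so for fixed \<open>d\<close>
  logarithms of \<open>m\<close> or of the input size need no separate treatment; \<open>n + 2\<close> instead of \<open>n\<close> only
  keeps the logarithm at least \<open>1\<close>.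
\<close>

definition soft_O :: "(nat \<Rightarrow> nat \<Rightarrow> real) \<Rightarrow> (nat \<Rightarrow> nat \<Rightarrow> real) set" where
  "soft_O g = {f. \<exists>(C::real) (c::nat). \<forall>n m. f n m \<le> C * log 2 (real n + 2) ^ c * g n m}"

definition substantially_sublinear_on ::
    "nat \<Rightarrow> (nat \<Rightarrow> nat \<Rightarrow> bool) \<Rightarrow> (nat \<Rightarrow> nat \<Rightarrow> nat) \<Rightarrow> bool" where
  "substantially_sublinear_on d Q f \<longleftrightarrow>
     (\<exists>\<epsilon>>0. \<exists>C::real. \<forall>n m. m \<ge> 1 \<longrightarrow> Q n m \<longrightarrow>
        real (f n m) \<le> C * real (input_size d m) powr (1 - \<epsilon>))"

text \<open>
  The model's requirements for \<open>K n m\<close> machines of space \<open>S n m\<close>, where the space allowance is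
  \<open>g n m\<close> up to polylogarithmic factors. On inputs so sparse that \<open>g\<close> itself is not substantially
  below the input size, sublinear space cannot be demanded in addition to the allowance.
\<close>

definition mpc_resources ::
    "nat \<Rightarrow> (nat \<Rightarrow> nat \<Rightarrow> real) \<Rightarrow> (nat \<Rightarrow> nat \<Rightarrow> nat) \<Rightarrow> (nat \<Rightarrow> nat \<Rightarrow> nat) \<Rightarrow> bool" where
  "mpc_resources d g K S \<longleftrightarrow>
     (\<lambda>n m. real (S n m)) \<in> soft_O g \<and>
     (\<lambda>n m. real (K n m) * real (S n m)) \<in> soft_O (\<lambda>n m. real (input_size d m)) \<and>
     substantially_sublinear_on d (\<lambda>n m. True) K \<and>
     (\<forall>\<epsilon>>0. substantially_sublinear_on d
        (\<lambda>n m. g n m \<le> real (input_size d m) powr (1 - \<epsilon>)) S)"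

end

theory Submission
  imports Defs
begin

text \<open>
  Since \<open>d \<le> (d - 1 + 1 / d)\<^sup>2\<close>, it suffices to store a subgraph that contains a maximal matching. This
  is achieved by filtering with \<open>k \<approx> sqrt (m / n)\<close> machines. Every machine samples about a
  \<open>1 / k\<close> fraction of its hyperedges for machine \<open>0\<close>, which computes a maximal matching \<open>M\<close> of what it
  receives and broadcasts it; then the hyperedges disjoint from \<open>M\<close> are sent to machine \<open>0\<close>.
  There are few of them: no sampled hyperedge avoids the vertices of \<open>M\<close>, but a fixed vertex set that
  is avoided by at least \<open>2 n k\<close> hyperedges is avoided by none of the samples with probability at
  most \<open>exp (- 2 n)\<close>, and there are only \<open>2 ^ n\<close> vertex sets. So \<open>O(d sqrt (n m))\<close> words
  per machine suffice even if the hypergraph is not linear.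
\<close>


section \<open>Maximal matchings\<close>

definition maximal_matching :: "'a set set \<Rightarrow> 'a set set \<Rightarrow> bool" where
  "maximal_matching E M \<longleftrightarrow> matching E M \<and> (\<forall>e\<in>E. \<exists>f\<in>M. \<not> disjnt e f)"

lemma card_Union_matching:
  assumes "matching E M" "\<And>e. e \<in> E \<Longrightarrow> finite e \<and> card e = d"
  shows "card (\<Union>M) = d * card M"
proof -
  have "card (\<Union>M) = (\<Sum>e\<in>M. card e)"
    using assms by (intro card_Union_disjoint) (auto simp: matching_def)
  also have "\<dots> = (\<Sum>e\<in>M. d)"
    using assms by (intro sum.cong) (auto simp: matching_def)
  finally show ?thesis by simp
qed

text \<open>Each hyperedge of \<open>N\<close> meets one of \<open>M\<close>. Choosing a common
  vertex for each is injective because \<open>N\<close> is pairwise disjoint, so \<open>N\<close> is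
  no larger than the set of vertices covered by \<open>M\<close>.\<close>

lemma card_matching_le_maximal:
  assumes "finite E" "\<And>e. e \<in> E \<Longrightarrow> finite e \<and> card e = d"
    and M: "maximal_matching E M" and N: "matching E N"
  shows "card N \<le> d * card M"
proof -
  have fin: "finite (\<Union>M)"
    using assms by (auto simp: maximal_matching_def matching_def intro: finite_subset)
  have "\<exists>v. v \<in> e \<and> v \<in> \<Union>M" if "e \<in> N" for e
  proof -
    have "e \<in> E" using N that by (auto simp: matching_def)
    then obtain f where "f \<in> M" "\<not> disjnt e f"
      using M by (auto simp: maximal_matching_def)
    then show ?thesis by (auto simp: disjnt_iff)
  qed
  then obtain g where g: "\<And>e. e \<in> N \<Longrightarrow> g e \<in> e \<and> g e \<in> \<Union>M"
    by metis
  have "inj_on g N"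
  proof (rule inj_onI, rule ccontr)
    fix e f assume "e \<in> N" "f \<in> N" "g e = g f" "e \<noteq> f"
    then have "disjnt e f" using N by (auto simp: matching_def pairwise_def)
    then show False
      using g[OF \<open>e \<in> N\<close>] g[OF \<open>f \<in> N\<close>] \<open>g e = g f\<close> by (auto simp: disjnt_iff)
  qed
  then have "card N \<le> card (\<Union>M)"
    using g fin by (intro card_inj_on_le) auto
  also have "\<dots> = d * card M"
    using M assms(2) by (intro card_Union_matching) (auto simp: maximal_matching_def)
  finally show ?thesis .
qed

lemma approx_maximal_matching:
  assumes "finite E" "\<And>e. e \<in> E \<Longrightarrow> finite e \<and> card e = d"
    and "maximal_matching E M" and "real d \<le> \<rho>"
  shows "approx_matching \<rho> E M"
proof -
  have "{N. matching E N} \<subseteq> Pow E"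
    by (auto simp: matching_def)
  then have "finite {N. matching E N}"
    using assms(1) finite_subset by blast
  moreover have "matching E {}"
    by (simp add: matching_def)
  ultimately have "matching_number E \<le> d * card M"
    unfolding matching_number_def
    using card_matching_le_maximal[OF assms(1-3)] by (subst Max_le_iff) auto
  then have "real (matching_number E) \<le> real d * real (card M)"
    by (metis of_nat_le_iff of_nat_mult)
  also have "\<dots> \<le> \<rho> * real (card M)"
    using assms by (intro mult_right_mono) auto
  finally show ?thesis
    using assms by (auto simp: approx_matching_def maximal_matching_def)
qed

primrec greedy_matching :: "'a set list \<Rightarrow> 'a set list" where
  "greedy_matching [] = []"
| "greedy_matching (e # es) =
     (let M = greedy_matching es in if \<forall>f\<in>set M. disjnt e f then e # M else M)"

lemma set_greedy_matching: "set (greedy_matching es) \<subseteq> set es"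
  by (induction es) (auto simp: Let_def)

text \<open>Nonemptiness matters: a chosen hyperedge is blocked by itself only if it meets
  itself.\<close>

lemma maximal_matching_greedy:
  assumes "{} \<notin> set es"
  shows "maximal_matching (set es) (set (greedy_matching es))"
  using assms
proof (induction es)
  case Nil
  then show ?case by (auto simp: maximal_matching_def matching_def)
next
  case (Cons e es)
  then show ?case
    by (auto simp: maximal_matching_def matching_def Let_def pairwise_insert disjnt_sym)
qed

lemma distinct_greedy_matching:
  assumes "{} \<notin> set es"
  shows "distinct (greedy_matching es)"
  using assms by (induction es) (auto simp: Let_def)

text \<open>A hyperedge of \<open>E\<close> either meets \<open>M\<close> or survives into the set
  in which \<open>N\<close> is maximal. With \<open>R\<close> the hyperedges received by machine 0,
  a matching found among them can be completed from the survivors alone.\<close>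

lemma maximal_matching_extend:
  assumes M: "maximal_matching R M" and "R \<subseteq> E"
    and N: "maximal_matching {e \<in> E. \<forall>f\<in>M. disjnt e f} N"
  shows "maximal_matching E (M \<union> N)"
proof -
  have disj: "disjnt e f" if "e \<in> N" "f \<in> M" for e f
    using N that by (auto simp: maximal_matching_def matching_def)
  then have "pairwise disjnt (M \<union> N)"
    using M N by (auto simp: maximal_matching_def matching_def pairwise_def disjnt_sym)
  moreover have "M \<union> N \<subseteq> E"
    using assms by (auto simp: maximal_matching_def matching_def)
  moreover have "\<exists>f\<in>M \<union> N. \<not> disjnt e f" if "e \<in> E" for e
    using N that by (cases "\<forall>f\<in>M. disjnt e f") (auto simp: maximal_matching_def)
  ultimately show ?thesis
    by (auto simp: maximal_matching_def matching_def)
qed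

lemma approximation_ratio_ge:
  assumes "d \<ge> 1"
  shows "real d \<le> (real d - 1 + 1 / real d)\<^sup>2"
proof (cases "d = 1")
  case False
  define x where "x = real d"
  have x: "x \<ge> 2" using assms False by (simp add: x_def)
  \<comment> \<open>Only the term \<open>1 / x^2\<close> of the expanded square is dropped. After
    multiplication by \<open>x\<close> the difference has the factor \<open>x - 2\<close>, which is
    why \<open>d = 1\<close> is treated apart.\<close>
  have "x \<le> (x - 1)\<^sup>2 + 2 * (x - 1) / x"
  proof -
    have "x * x \<le> x * (x - 1)\<^sup>2 + 2 * (x - 1)"
    proof -
      have "x * (x - 1)\<^sup>2 + 2 * (x - 1) - x * x = (x - 2) * (x * (x - 1) + 1)"
        by (simp add: power2_eq_square algebra_simps)
      moreover have "(x - 2) * (x * (x - 1) + 1) \<ge> 0" using x by simp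
      ultimately show ?thesis by linarith
    qed
    then show ?thesis using x by (simp add: field_simps)
  qed
  also have "\<dots> \<le> (x - 1 + 1 / x)\<^sup>2"
    using x by (simp add: power2_sum power_divide)
  finally show ?thesis by (simp add: x_def)
qed simp

section \<open>Messages\<close>

text \<open>Block number \<open>j\<close> of length \<open>c\<close>, empty beyond the end of the
  list. The same cutting parses messages, spreads hyperedges over machines and builds a
  placement.\<close>

definition chunk :: "nat \<Rightarrow> nat \<Rightarrow> 'a list \<Rightarrow> 'a list" where
  "chunk c j xs = take c (drop (j * c) xs)"

lemma length_chunk_le: "length (chunk c j xs) \<le> c"
  by (simp add: chunk_def)

lemma concat_chunks: "concat (map (\<lambda>j. chunk c j xs) [0..<k]) = take (k * c) xs"
proof (induction k)
  case (Suc k)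
  have "take (Suc k * c) xs = take (k * c + c) xs" by (simp add: add.commute)
  then show ?case using Suc by (simp only: take_add) (simp add: chunk_def)
qed simp

lemma le_mult_Suc_div: "0 < k \<Longrightarrow> n \<le> k * (n div k + 1)" for k n :: nat
  using dividend_less_times_div[of k n] by simp

text \<open>Messages carry no separators; since every hyperedge takes exactly \<open>d\<close>
  words, cutting at multiples of \<open>d\<close> recovers them, even from several concatenated
  messages.\<close>

definition decode_edges :: "nat \<Rightarrow> word_list \<Rightarrow> nat set list" where
  "decode_edges d ws = map (\<lambda>i. set (chunk d i ws)) [0..<length ws div d]"

lemma encode_edges_append [simp]: "encode_edges (es @ fs) = encode_edges es @ encode_edges fs"
  by (simp add: encode_edges_def)

lemma encode_edges_Nil [simp]: "encode_edges [] = []"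
  by (simp add: encode_edges_def)

lemma concat_encode_edges:
  "concat (map (\<lambda>i. encode_edges (f i)) is) = encode_edges (concat (map f is))"
  by (induction "is") auto

lemma length_encode_edges:
  assumes "\<And>e. e \<in> set es \<Longrightarrow> card e = d"
  shows "length (encode_edges es) = d * length es"
  using assms by (induction es) (auto simp: encode_edges_def)

lemma set_encode_edges:
  assumes "\<And>e. e \<in> set es \<Longrightarrow> finite e"
  shows "set (encode_edges es) = \<Union>(set es)"
  using assms by (induction es) (auto simp: encode_edges_def)

lemma decode_encode_edges:
  assumes "d \<ge> 1" "\<And>e. e \<in> set es \<Longrightarrow> finite e \<and> card e = d"
  shows "decode_edges d (encode_edges es) = es"
  using assms(2)
proof (induction es)
  case Nil
  then show ?case by (simp add: decode_edges_def)
next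
  case (Cons e es)
  define ws where "ws = encode_edges es"
  have len: "length (sorted_list_of_set e) = d" and fin: "finite e"
    using Cons.prems by auto
  have "decode_edges d (encode_edges (e # es)) =
      map (\<lambda>i. set (chunk d i (sorted_list_of_set e @ ws))) [0..<Suc (length ws div d)]"
    using len assms(1) by (simp add: decode_edges_def encode_edges_def ws_def)
  also have "\<dots> = e # map (\<lambda>i. set (chunk d (Suc i) (sorted_list_of_set e @ ws))) [0..<length ws div d]"
    using len fin
    by (simp add: chunk_def upt_conv_Cons map_Suc_upt[symmetric] o_def del: upt_Suc)
  also have "\<dots> = e # decode_edges d ws"
    using len by (simp add: chunk_def decode_edges_def)
  finally show ?case using Cons by (simp add: ws_def)
qed

text \<open>The rows outside the \<open>k\<close> machines are empty, as in the default value of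
  \<open>Pi_pmf\<close>, so that the outcome of a deterministic round equals such a matrix
  literally.\<close>

definition traffic_of :: "nat \<Rightarrow> (nat \<Rightarrow> nat \<Rightarrow> nat set list) \<Rightarrow> traffic" where
  "traffic_of k B = (\<lambda>i. if i < k then (\<lambda>j. encode_edges (B i j)) else (\<lambda>_. []))"

lemma traffic_of_eq [simp]: "i < k \<Longrightarrow> traffic_of k B i j = encode_edges (B i j)"
  by (simp add: traffic_of_def)

lemma concat_inbox:
  "concat (map (\<lambda>j. traffic_of k B j i) [0..<k]) = encode_edges (concat (map (\<lambda>j. B j i) [0..<k]))"
  by (subst concat_encode_edges[symmetric]) (auto intro!: arg_cong[where f = concat])

lemma within_limits_traffic_of:
  assumes "\<And>e. e \<in> E \<Longrightarrow> e \<subseteq> {..<n} \<and> card e = d"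
    and "\<And>i j. i < k \<Longrightarrow> j < k \<Longrightarrow> set (B i j) \<subseteq> E"
    and "\<And>i. i < k \<Longrightarrow> d * (\<Sum>j<k. length (B i j)) \<le> s"
    and "\<And>i. i < k \<Longrightarrow> d * (\<Sum>j<k. length (B j i)) \<le> s"
  shows "within_limits n k s (traffic_of k B)"
proof -
  have len: "length (encode_edges (B i j)) = d * length (B i j)" if "i < k" "j < k" for i j
    using assms(1) assms(2)[OF that] by (intro length_encode_edges) auto
  have "set (encode_edges (B i j)) \<subseteq> {..<n}" if "i < k" "j < k" for i j
  proof -
    have "set (encode_edges (B i j)) = \<Union>(set (B i j))"
      using assms(1) assms(2)[OF that] by (intro set_encode_edges) (meson finite_lessThan finite_subset subsetD)
    also have "\<dots> \<subseteq> {..<n}"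
      using assms(1) assms(2)[OF that] by blast
    finally show ?thesis .
  qed
  with assms(3,4) show ?thesis
    by (simp add: within_limits_def len sum_distrib_left)
qed

text \<open>
  The memories may be full initially. So the sampled hyperedges \<open>X\<close> are moved to machine \<open>0\<close>, not
  copied, and the others are spread evenly, which makes room for the samples and the broadcast.
\<close>

definition scatter :: "nat \<Rightarrow> 'a list \<Rightarrow> 'a set \<Rightarrow> nat \<Rightarrow> 'a list" where
  "scatter k es X j = (if j = 0 then filter (\<lambda>e. e \<in> X) es else []) @
     chunk (length es div k + 1) j (filter (\<lambda>e. e \<notin> X) es)"

lemma mset_concat_upt: "mset (concat (map f [0..<k])) = (\<Sum>j<k. mset (f j))"
  by (induction k) (auto simp: add.commute)

lemma length_concat_upt: "length (concat (map f [0..<k])) = (\<Sum>j<k. length (f j))"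
  by (induction k) auto

text \<open>The \<open>k\<close> blocks have room for
  \<open>k * (length es div k + 1) \<ge> length es\<close> hyperedges, so none is lost. Multisets
  record at the same time that none is duplicated.\<close>

lemma sum_mset_scatter:
  assumes "k > 0"
  shows "(\<Sum>j<k. mset (scatter k es X j)) = mset es"
proof -
  define c where "c = length es div k + 1"
  define F where "F = filter (\<lambda>e. e \<notin> X) es"
  have "length F \<le> length es" by (simp add: F_def)
  also have "\<dots> \<le> k * c" unfolding c_def by (rule le_mult_Suc_div[OF assms])
  finally have "concat (map (\<lambda>j. chunk c j F) [0..<k]) = F"
    by (simp add: concat_chunks)
  then have "(\<Sum>j<k. mset (chunk c j F)) = mset F"
    by (metis mset_concat_upt)
  moreover have "(\<Sum>j<k. mset (if j = 0 then filter (\<lambda>e. e \<in> X) es else [])) =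
      mset (filter (\<lambda>e. e \<in> X) es)"
    using assms by (subst sum.remove[of _ 0]) (auto intro!: sum.neutral)
  ultimately have "(\<Sum>j<k. mset (scatter k es X j)) = filter_mset (\<lambda>e. e \<in> X) (mset es) + mset F"
    by (simp add: scatter_def sum.distrib c_def F_def)
  also have "\<dots> = mset es"
    by (simp add: F_def flip: multiset_partition)
  finally show ?thesis .
qed

text \<open>One half of the bound is for the samples, which have at most as many distinct members as
  there were draws; the other half is for the block of unsampled hyperedges.\<close>

lemma length_scatter_le:
  assumes "distinct es" "X = set xs" "length xs = length es div k + 1"
  shows "length (scatter k es X j) \<le> 2 * (length es div k + 1)"
proof -
  have "length (filter (\<lambda>e. e \<in> X) es) = card (set (filter (\<lambda>e. e \<in> X) es))"
    using assms(1) by (metis distinct_card distinct_filter)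
  also have "\<dots> \<le> card (set xs)"
    using assms(2) by (intro card_mono) auto
  also have "\<dots> \<le> length es div k + 1"
    using assms(3) card_length by metis
  finally show ?thesis
    using length_chunk_le[of "length es div k + 1" j "filter (\<lambda>e. e \<notin> X) es"]
    by (cases "j = 0") (simp_all add: scatter_def)
qed

lemma set_scatter_subset: "set (scatter k es X j) \<subseteq> set es"
  using set_take_subset set_drop_subset by (fastforce simp: scatter_def chunk_def dest: in_set_takeD in_set_dropD)

section \<open>The protocol and its sampling\<close>

text \<open>Sampling is with replacement, which makes the draws independent. For a machine without
  hyperedges \<open>pmf_of_set\<close> is unspecified, but \<open>scatter\<close> only selects from
  \<open>es\<close>, so nothing is sent. In round 1 machine 0 forgets its hyperedges outside the
  matching, while the others keep theirs by sending them to themselves.\<close>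

definition filtering_protocol :: "nat \<Rightarrow> nat \<Rightarrow> protocol" where
  "filtering_protocol d k r i inbox =
     (let es = decode_edges d (concat (map inbox [0..<k])) in
      if r = 0 then
        map_pmf (\<lambda>xs j. encode_edges (scatter k es (set xs) j))
          (replicate_pmf (length es div k + 1) (pmf_of_set (set es)))
      else if r = 1 then
        return_pmf (\<lambda>j. encode_edges
          (if i = 0 then greedy_matching es else if j = i then es else []))
      else
        let M = decode_edges d (inbox 0) in
        return_pmf (\<lambda>j. encode_edges
          (if j \<noteq> 0 then [] else if i = 0 then M
           else filter (\<lambda>e. \<forall>f\<in>set M. disjnt e f) (decode_edges d (inbox i)))))"

lemma mpc_round_deterministic:
  assumes "\<And>i. i < k \<Longrightarrow> A r i (\<lambda>j. T j i) = return_pmf (\<lambda>j. encode_edges (B i j))"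
  shows "mpc_round k A r T = return_pmf (traffic_of k B)"
proof -
  have "mpc_round k A r T = Pi_pmf {..<k} (\<lambda>_. []) (\<lambda>i. return_pmf (\<lambda>j. encode_edges (B i j)))"
    unfolding mpc_round_def using assms by (intro Pi_pmf_cong) auto
  also have "\<dots> = return_pmf (traffic_of k B)"
    by (simp add: traffic_of_def)
  finally show ?thesis .
qed

section \<open>Probability that draws with replacement avoid a set\<close>

lemma prob_replicate_pmf_avoid:
  "measure_pmf.prob (replicate_pmf t p) {xs. set xs \<inter> F = {}} = measure_pmf.prob p (- F) ^ t"
proof -
  have "emeasure (replicate_pmf t p) {xs. set xs \<inter> F = {}} = emeasure p (- F) ^ t"
  proof (induction t)
    case (Suc t)
    have "emeasure (replicate_pmf (Suc t) p) {xs. set xs \<inter> F = {}} =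
        (\<integral>\<^sup>+x. emeasure (replicate_pmf t p) {xs. set (x # xs) \<inter> F = {}} \<partial>p)"
      by (simp add: map_pmf_def[symmetric] vimage_def del: set_simps)
    also have "\<dots> = (\<integral>\<^sup>+x. emeasure p (- F) ^ t * indicator (- F) x \<partial>p)"
      using Suc by (intro nn_integral_cong) (auto split: split_indicator)
    also have "\<dots> = emeasure p (- F) ^ Suc t"
      by (subst nn_integral_cmult_indicator) (simp_all add: mult.commute)
    finally show ?case .
  qed simp
  then show ?thesis
    by (simp add: measure_pmf.emeasure_eq_measure ennreal_power)
qed

text \<open>There are at least \<open>card A / k\<close> draws, and each avoids \<open>F\<close>
  with probability \<open>1 - card F / card A\<close>, which is at most
  \<open>exp (- card F / card A)\<close>. If \<open>A\<close> is empty, so is \<open>F\<close>, and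
  the bound is 1.\<close>

lemma prob_sample_avoid_le:
  assumes "finite A" "F \<subseteq> A" "k > 0"
  shows "measure_pmf.prob (replicate_pmf (card A div k + 1) (pmf_of_set A)) {xs. set xs \<inter> F = {}}
    \<le> exp (- (real (card F) / real k))"
proof (cases "A = {}")
  case False
  define L where "L = real (card A)"
  define t where "t = card A div k + 1"
  have L: "L > 0" using assms False by (simp add: L_def card_gt_0_iff)
  have fle: "real (card F) \<le> L" using assms by (simp add: L_def card_mono)
  have "card A \<le> k * t" unfolding t_def by (rule le_mult_Suc_div[OF assms(3)])
  then have "L \<le> real k * real t" unfolding L_def by (metis of_nat_le_iff of_nat_mult)
  then have t: "1 / real k \<le> real t / L" using L assms(3) by (simp add: field_simps)
  have "measure_pmf.prob (pmf_of_set A) (- F) = real (card (A - F)) / L"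
    using assms False by (simp add: measure_pmf_of_set L_def Diff_eq)
  also have "\<dots> = 1 - real (card F) / L"
    using L fle assms False finite_subset[OF assms(2,1)]
    by (simp add: card_Diff_subset L_def of_nat_diff card_mono diff_divide_distrib)
  finally have "measure_pmf.prob (pmf_of_set A) (- F) = 1 - real (card F) / L" .
  then have "measure_pmf.prob (replicate_pmf t (pmf_of_set A)) {xs. set xs \<inter> F = {}} =
      (1 - real (card F) / L) ^ t"
    by (simp add: prob_replicate_pmf_avoid)
  also have "\<dots> \<le> exp (- (real (card F) / L)) ^ t"
    using exp_ge_add_one_self[of "- (real (card F) / L)"] L fle by (intro power_mono) auto
  also have "\<dots> = exp (- (real (card F) * (real t / L)))"
    by (simp add: mult_ac flip: exp_of_nat_mult)
  also have "\<dots> \<le> exp (- (real (card F) * (1 / real k)))"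
    using mult_left_mono[OF t, of "real (card F)"] by simp
  finally show ?thesis by (simp add: t_def)
qed (use assms in auto)

text \<open>Brings round 0 to the front, the only round in which the filtering protocol is
  random.\<close>

lemma mpc_run_3:
  "mpc_run k A T 3 = bind_pmf (mpc_round k A 0 T) (\<lambda>T\<^sub>1. bind_pmf (mpc_round k A 1 T\<^sub>1)
     (\<lambda>T\<^sub>2. map_pmf (\<lambda>T\<^sub>3. [T\<^sub>3, T\<^sub>2, T\<^sub>1, T]) (mpc_round k A 2 T\<^sub>2)))"
  by (simp add: numeral_3_eq_3 numeral_2_eq_2 bind_return_pmf map_pmf_def bind_assoc_pmf)

section \<open>Correctness of a run\<close>

locale filtering_instance =
  fixes d n k s :: nat and E :: "nat set set" and P :: "nat \<Rightarrow> nat set list"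
  assumes d_pos: "d \<ge> 1" and k_pos: "k > 0"
    and uniform: "uniform_hypergraph d {..<n} E"
    and placement: "placement k s E P"
begin

lemma edgeD: "e \<in> E \<Longrightarrow> e \<subseteq> {..<n} \<and> card e = d"
  using uniform by (auto simp: uniform_hypergraph_def)

lemma finite_edge: "e \<in> E \<Longrightarrow> finite e"
  using edgeD finite_subset by blast

lemma nonempty_edge: "{} \<notin> E"
  using edgeD[of "{}"] d_pos by auto

lemma finite_edges: "finite E"
proof -
  have "E \<subseteq> Pow {..<n}" using edgeD by auto
  then show ?thesis using finite_subset by blast
qed

lemma set_P_subset: "i < k \<Longrightarrow> set (P i) \<subseteq> E"
  using placement by (auto simp: placement_def)

lemma distinct_P: "i < k \<Longrightarrow> distinct (P i)"
  using placement by (auto simp: placement_def)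

text \<open>Multisets express that each hyperedge is stored exactly once. The induction needs the
  version for the first \<open>l\<close> machines.\<close>

lemma mset_P: "(\<Sum>i<k. mset (P i)) = mset_set E"
proof -
  have "(\<Sum>i<l. mset (P i)) = mset_set (\<Union>i<l. set (P i))" if "l \<le> k" for l
    using that
  proof (induction l)
    case (Suc l)
    have "(\<Union>i<l. set (P i)) \<inter> set (P l) = {}"
    proof -
      have "set (P i) \<inter> set (P l) = {}" if "i < l" for i
        using placement Suc.prems that by (simp add: placement_def disjoint_family_on_def)
      then show ?thesis by blast
    qed
    then have "mset_set (set (P l) \<union> (\<Union>i<l. set (P i))) = mset (P l) + mset_set (\<Union>i<l. set (P i))"
      using distinct_P[of l] Suc.prems by (subst mset_set_Union) (auto simp: mset_set_set)
    then show ?case using Suc by (simp add: lessThan_Suc add.commute)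
  qed simp
  from this[of k] show ?thesis
    using placement by (simp add: placement_def)
qed

lemma sum_length_P: "(\<Sum>i<k. length (P i)) = card E"
proof -
  have "size (\<Sum>i<k. mset (P i)) = card E" by (simp add: mset_P)
  then show ?thesis by (simp add: size_multiset_sum)
qed

lemma decode_inbox:
  assumes "\<And>j. j < k \<Longrightarrow> set (B j i) \<subseteq> E"
  shows "decode_edges d (concat (map (\<lambda>j. traffic_of k B j i) [0..<k])) =
    concat (map (\<lambda>j. B j i) [0..<k])"
proof -
  have "set (concat (map (\<lambda>j. B j i) [0..<k])) \<subseteq> E"
    using subsetD[OF assms] by auto
  then show ?thesis
    unfolding concat_inbox using edgeD finite_edge d_pos by (intro decode_encode_edges) blast+
qed

lemma decode_message:
  assumes "i < k" "set (B i j) \<subseteq> E"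
  shows "decode_edges d (traffic_of k B i j) = B i j"
  using assms edgeD finite_edge d_pos by (subst traffic_of_eq) (auto intro!: decode_encode_edges)

lemma initial_traffic_eq: "initial_traffic k P = traffic_of k (\<lambda>i j. if i = j then P i else [])"
  by (auto simp: initial_traffic_def traffic_of_def fun_eq_iff)

lemma concat_singleton_inbox: "i < k \<Longrightarrow> concat (map (\<lambda>j. if j = i then f j else []) [0..<k]) = f i"
proof -
  assume "i < k"
  have "concat (map (\<lambda>j. if j = i then f j else []) [0..<l]) = (if i < l then f i else [])" for l
    by (induction l) auto
  with \<open>i < k\<close> show ?thesis by simp
qed

lemma decode_initial:
  assumes "i < k"
  shows "decode_edges d (concat (map (\<lambda>j. initial_traffic k P j i) [0..<k])) = P i"
  unfolding initial_traffic_eq using assms set_P_subset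
  by (subst decode_inbox) (auto simp: concat_singleton_inbox)

end

text \<open>Once the samples are drawn, the run is deterministic. \<open>X i\<close> is the set
  drawn by machine \<open>i\<close>; only the number of draws is recorded, which is what bounds the
  messages. How likely a small residual is gets treated separately.\<close>

locale filtering_run = filtering_instance +
  fixes X :: "nat \<Rightarrow> nat set set"
  assumes sample_size: "\<And>i. i < k \<Longrightarrow> \<exists>xs. X i = set xs \<and> length xs = length (P i) div k + 1"
begin

definition scattered :: "nat \<Rightarrow> nat \<Rightarrow> nat set list" where
  "scattered i j = scatter k (P i) (X i) j"

definition received :: "nat \<Rightarrow> nat set list" where
  "received j = concat (map (\<lambda>i. scattered i j) [0..<k])"

definition coarse_matching :: "nat set list" where
  "coarse_matching = greedy_matching (received 0)"

definition residual :: "nat set set" where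
  "residual = {e \<in> E. \<forall>f\<in>set coarse_matching. disjnt e f}"

definition broadcast :: "nat \<Rightarrow> nat \<Rightarrow> nat set list" where
  "broadcast i j = (if i = 0 then coarse_matching else if j = i then received i else [])"

definition collected :: "nat \<Rightarrow> nat \<Rightarrow> nat set list" where
  "collected i j = (if j \<noteq> 0 then [] else if i = 0 then coarse_matching
     else filter (\<lambda>e. \<forall>f\<in>set coarse_matching. disjnt e f) (received i))"

lemma set_scattered_subset: "i < k \<Longrightarrow> set (scattered i j) \<subseteq> E"
  unfolding scattered_def by (rule order_trans[OF set_scatter_subset set_P_subset])

lemma set_received_subset: "set (received j) \<subseteq> E"
proof
  fix e assume "e \<in> set (received j)"
  then obtain i where "i < k" "e \<in> set (scattered i j)"
    by (auto simp: received_def)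
  then show "e \<in> E" using subsetD[OF set_scattered_subset] by simp
qed

text \<open>Exchanging the sums turns what all machines receive into what all machines send, and
  scattering preserves the hyperedges of each sender.\<close>

lemma mset_received: "mset (concat (map received [0..<k])) = mset_set E"
proof -
  have "mset (concat (map received [0..<k])) = (\<Sum>j<k. \<Sum>i<k. mset (scattered i j))"
    by (simp add: mset_concat_upt received_def)
  also have "\<dots> = (\<Sum>i<k. \<Sum>j<k. mset (scattered i j))"
    by (rule sum.swap)
  also have "\<dots> = mset_set E"
    using k_pos by (simp add: scattered_def sum_mset_scatter mset_P)
  finally show ?thesis .
qed

lemma union_received: "(\<Union>j<k. set (received j)) = E"
proof -
  have "set_mset (mset (concat (map received [0..<k]))) = E"
    by (simp only: mset_received) (simp add: finite_edges)
  then show ?thesis by (simp add: atLeast0LessThan)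
qed

lemma distinct_received: "distinct (concat (map received [0..<k]))"
proof -
  obtain xs where xs: "set xs = E" "distinct xs"
    using finite_distinct_list[OF finite_edges] by blast
  then have "mset (concat (map received [0..<k])) = mset xs"
    unfolding mset_received by (auto simp: mset_set_set)
  from mset_eq_imp_distinct_iff[OF this] xs(2) show ?thesis by (simp only:)
qed

text \<open>Every hyperedge arrives exactly once, so the lengths add up to a cardinality without
  overcounting.\<close>

lemma sum_length_residual:
  "(\<Sum>j<k. length (filter (\<lambda>e. \<forall>f\<in>set coarse_matching. disjnt e f) (received j))) = card residual"
proof -
  let ?p = "\<lambda>e. \<forall>f\<in>set coarse_matching. disjnt e f"
  let ?rs = "concat (map received [0..<k])"
  have "set (filter ?p ?rs) = residual"
    using union_received by (auto simp: residual_def atLeast0LessThan)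
  then have "card residual = length (filter ?p ?rs)"
    using distinct_card[OF distinct_filter[OF distinct_received, of ?p]] by (simp only:)
  then show ?thesis
    by (simp only: filter_concat map_map comp_def length_concat_upt)
qed

text \<open>Sender \<open>i\<close> contributes at most two batches of size
  \<open>length (P i) div k + 1\<close>. The summands 1 add up to \<open>k\<close>, and a sum of
  integer quotients is at most the quotient of the sum.\<close>

lemma length_received_le: "length (received j) \<le> 2 * (card E div k + k)"
proof -
  have "length (scattered i j) \<le> 2 * (length (P i) div k + 1)" if i: "i < k" for i
  proof -
    obtain xs where xs: "X i = set xs" "length xs = length (P i) div k + 1"
      using sample_size[OF i] by (elim exE conjE) (rule that)
    show ?thesis
      unfolding scattered_def by (rule length_scatter_le[OF distinct_P[OF i] xs])
  qed
  then have "length (received j) \<le> (\<Sum>i<k. 2 * (length (P i) div k + 1))"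
    unfolding received_def length_concat_upt by (intro sum_mono) auto
  also have "\<dots> = 2 * ((\<Sum>i<k. length (P i) div k) + k)"
    by (simp only: sum_distrib_left[symmetric] sum.distrib) simp
  finally have "length (received j) \<le> 2 * ((\<Sum>i<k. length (P i) div k) + k)" .
  moreover have "(\<Sum>i<k. length (P i) div k) * k \<le> card E"
    unfolding sum_length_P[symmetric]
    by (simp only: sum_distrib_right) (intro sum_mono div_times_less_eq_dividend)
  then have "(\<Sum>i<k. length (P i) div k) \<le> card E div k"
    using k_pos by (simp add: less_eq_div_iff_mult_less_eq)
  ultimately show ?thesis by (meson add_le_mono1 le_trans mult_le_mono2)
qed

lemma maximal_coarse_matching: "maximal_matching (set (received 0)) (set coarse_matching)"
  unfolding coarse_matching_def using set_received_subset nonempty_edge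
  by (intro maximal_matching_greedy) auto

lemma set_coarse_matching: "set coarse_matching \<subseteq> set (received 0)"
  using set_greedy_matching by (auto simp: coarse_matching_def)

lemma coarse_matching_subset: "set coarse_matching \<subseteq> E"
  using set_coarse_matching set_received_subset by blast

lemma set_broadcast_subset: "set (broadcast i j) \<subseteq> E"
  using set_received_subset coarse_matching_subset by (auto simp: broadcast_def)

lemma set_collected_subset: "set (collected i j) \<subseteq> E"
  using set_received_subset coarse_matching_subset by (auto simp: collected_def)

lemma length_coarse_matching: "length coarse_matching = card (set coarse_matching)"
proof -
  have "{} \<notin> set (received 0)"
    using set_received_subset nonempty_edge by blast
  then show ?thesis
    unfolding coarse_matching_def by (rule distinct_card[OF distinct_greedy_matching, symmetric])
qed

text \<open>The matching consists of disjoint \<open>d\<close>-sets among \<open>n\<close> vertices.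
  Hence a copy of it costs at most \<open>n\<close> words, however many hyperedges there
  are.\<close>

lemma length_coarse_matching_le: "d * length coarse_matching \<le> n"
proof -
  have "d * length coarse_matching = card (\<Union>(set coarse_matching))"
    unfolding length_coarse_matching using maximal_coarse_matching set_received_subset edgeD finite_edge
    by (intro card_Union_matching[symmetric, of "set (received 0)"])
      (auto simp: maximal_matching_def)
  also have "\<dots> \<le> card {..<n}"
    using coarse_matching_subset edgeD by (intro card_mono) blast+
  finally show ?thesis by simp
qed

lemma round_1:
  "mpc_round k (filtering_protocol d k) 1 (traffic_of k scattered) = return_pmf (traffic_of k broadcast)"
proof (rule mpc_round_deterministic)
  fix i assume "i < k"
  have "decode_edges d (concat (map (\<lambda>j. traffic_of k scattered j i) [0..<k])) = received i"
    using set_scattered_subset by (subst decode_inbox) (auto simp: received_def)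
  then show "filtering_protocol d k 1 i (\<lambda>j. traffic_of k scattered j i) =
      return_pmf (\<lambda>j. encode_edges (broadcast i j))"
    by (cases "i = 0")
      (simp_all add: filtering_protocol_def broadcast_def coarse_matching_def Let_def)
qed

lemma round_2:
  "mpc_round k (filtering_protocol d k) 2 (traffic_of k broadcast) = return_pmf (traffic_of k collected)"
proof (rule mpc_round_deterministic)
  fix i assume i: "i < k"
  have "decode_edges d (traffic_of k broadcast 0 i) = coarse_matching"
    by (subst decode_message[where B = broadcast, OF k_pos set_broadcast_subset]) (simp add: broadcast_def)
  moreover have "decode_edges d (traffic_of k broadcast i i) = received i" if "i \<noteq> 0"
    using that by (subst decode_message[where B = broadcast, OF i set_broadcast_subset]) (simp add: broadcast_def)
  ultimately show "filtering_protocol d k 2 i (\<lambda>j. traffic_of k broadcast j i) =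
      return_pmf (\<lambda>j. encode_edges (collected i j))"
    by (auto simp: filtering_protocol_def collected_def fun_eq_iff Let_def)
qed

text \<open>The coarse matching is maximal among the hyperedges received by machine 0, so none of
  these is residual. This is why machine 0 may forget them.\<close>

lemma residual_eq:
  "residual = (\<Union>i\<in>{1..<k}. {e \<in> set (received i). \<forall>f\<in>set coarse_matching. disjnt e f})"
proof -
  have "\<exists>i\<in>{1..<k}. e \<in> set (received i)" if "e \<in> residual" for e
  proof -
    have e: "e \<in> (\<Union>j<k. set (received j))"
      unfolding union_received using that by (simp add: residual_def)
    have "e \<notin> set (received 0)"
      using maximal_coarse_matching that by (auto simp: maximal_matching_def residual_def)
    moreover obtain i where "i < k" "e \<in> set (received i)"
      using e by blast
    ultimately have "i \<in> {1..<k}" by (cases i) auto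
    with \<open>e \<in> set (received i)\<close> show ?thesis by blast
  qed
  then show ?thesis
    using set_received_subset by (auto simp: residual_def)
qed

lemma set_stored: "set (concat (map (\<lambda>i. collected i 0) [0..<k])) = set coarse_matching \<union> residual"
proof -
  have "{0..<k} = insert 0 {1..<k}" using k_pos by auto
  then show ?thesis
    unfolding residual_eq by (auto simp: collected_def)
qed

text \<open>A greedy matching of the residual completes the coarse matching to a maximal matching of
  \<open>E\<close>, and both parts are stored.\<close>

lemma stored_approximation:
  assumes "real d \<le> \<rho>"
  shows "\<exists>M\<subseteq>set coarse_matching \<union> residual. approx_matching \<rho> E M"
proof -
  have "finite residual" using finite_edges by (simp add: residual_def)
  then obtain rs where rs: "set rs = residual" using finite_list by blast
  have "maximal_matching residual (set (greedy_matching rs))"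
    unfolding rs[symmetric] using rs nonempty_edge
    by (intro maximal_matching_greedy) (auto simp: residual_def)
  then have "maximal_matching E (set coarse_matching \<union> set (greedy_matching rs))"
    using maximal_coarse_matching set_received_subset
    by (intro maximal_matching_extend) (auto simp: residual_def)
  then have "approx_matching \<rho> E (set coarse_matching \<union> set (greedy_matching rs))"
    using finite_edges edgeD finite_edge assms by (intro approx_maximal_matching) auto
  then show ?thesis
    using set_greedy_matching[of rs] rs by blast
qed

section \<open>Space and communication limits of each traffic matrix\<close>

lemma within_limits_initial: "within_limits n k s (initial_traffic k P)"
proof -
  have "d * length (P i) \<le> s" if "i < k" for i
  proof -
    have "length (encode_edges (P i)) = d * length (P i)"
      using set_P_subset[OF that] edgeD by (intro length_encode_edges) auto
    then show ?thesis
      using placement that by (auto simp: placement_def)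
  qed
  moreover have "(\<Sum>j<k. length (if i = j then P i else [])) = length (P i)"
    "(\<Sum>j<k. length (if j = i then P j else [])) = length (P i)" if "i < k" for i
    using that by (auto simp: if_distrib cong: if_cong)
  ultimately show ?thesis
    unfolding initial_traffic_eq using edgeD subsetD[OF set_P_subset]
    by (intro within_limits_traffic_of[of E]) (auto split: if_splits)
qed

text \<open>Hyperedges are moved and not copied, so a machine sends no more than it held initially;
  only the incoming traffic needs an assumption.\<close>

lemma within_limits_scattered:
  assumes "\<And>j. j < k \<Longrightarrow> d * length (received j) \<le> s"
  shows "within_limits n k s (traffic_of k scattered)"
proof (intro within_limits_traffic_of[of E])
  fix i assume i: "i < k"
  have "size (\<Sum>j<k. mset (scattered i j)) = length (P i)"
    unfolding scattered_def sum_mset_scatter[OF k_pos] by simp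
  then have "(\<Sum>j<k. length (scattered i j)) = length (P i)"
    by (simp add: size_multiset_sum)
  moreover have "length (encode_edges (P i)) = d * length (P i)"
    using set_P_subset[OF i] edgeD by (intro length_encode_edges) auto
  ultimately show "d * (\<Sum>j<k. length (scattered i j)) \<le> s"
    using placement i by (auto simp: placement_def)
  have "(\<Sum>j<k. length (scattered j i)) = length (received i)"
    by (simp add: received_def length_concat_upt)
  then show "d * (\<Sum>j<k. length (scattered j i)) \<le> s"
    using assms[OF i] by simp
qed (use edgeD set_scattered_subset in auto)

text \<open>The exception for \<open>j = 0\<close> reflects that machine 0 keeps the matching but
  not the received list. It matters for a single machine, whose space may be exactly the input
  size.\<close>

lemma within_limits_broadcast:
  assumes "\<And>j. j < k \<Longrightarrow> d * (length (received j) + (if j = 0 then 0 else length coarse_matching)) \<le> s"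
    and "k * (d * length coarse_matching) \<le> s"
  shows "within_limits n k s (traffic_of k broadcast)"
proof (intro within_limits_traffic_of[of E])
  fix i assume i: "i < k"
  have "d * length coarse_matching \<le> k * (d * length coarse_matching)"
    using k_pos by simp
  also note assms(2)
  finally have M: "d * length coarse_matching \<le> s" .
  show "d * (\<Sum>j<k. length (broadcast i j)) \<le> s"
  proof (cases "i = 0")
    case True
    then show ?thesis using assms(2) by (simp add: broadcast_def mult_ac)
  next
    case False
    then have "(\<Sum>j<k. length (broadcast i j)) = length (received i)"
      using i by (simp add: broadcast_def if_distrib cong: if_cong)
    then show ?thesis using assms(1)[OF i] False by (simp add: distrib_left)
  qed
  have "(\<Sum>j<k. length (broadcast j i)) = (\<Sum>j<k. (if j = 0 then length coarse_matching else 0) +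
      (if j = i then (if i = 0 then 0 else length (received i)) else 0))"
    by (intro sum.cong) (auto simp: broadcast_def)
  also have "\<dots> = length coarse_matching + (if i = 0 then 0 else length (received i))"
    using i k_pos by (simp add: sum.distrib)
  finally show "d * (\<Sum>j<k. length (broadcast j i)) \<le> s"
    using assms(1)[OF i] M by (auto simp: add.commute split: if_splits)
qed (use edgeD set_broadcast_subset in auto)

lemma within_limits_collected:
  assumes "\<And>j. j < k \<Longrightarrow> d * length (received j) \<le> s"
    and "d * (length coarse_matching + card residual) \<le> s"
  shows "within_limits n k s (traffic_of k collected)"
proof (intro within_limits_traffic_of[of E])
  fix i assume i: "i < k"
  have "(\<Sum>j<k. length (collected i j)) = length (collected i 0)"
    using k_pos by (subst sum.remove[of _ 0]) (auto simp: collected_def)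
  also have "d * \<dots> \<le> s"
  proof (cases "i = 0")
    case True
    then show ?thesis using assms(2) by (simp add: collected_def distrib_left)
  next
    case False
    then have "d * length (collected i 0) \<le> d * length (received i)"
      by (simp add: collected_def)
    then show ?thesis using assms(1)[OF i] by linarith
  qed
  finally show "d * (\<Sum>j<k. length (collected i j)) \<le> s" .
  show "d * (\<Sum>j<k. length (collected j i)) \<le> s"
  proof (cases "i = 0")
    case True
    have "(\<Sum>j<k. length (collected j 0)) \<le> (\<Sum>j<k. (if j = 0 then length coarse_matching else 0) +
        length (filter (\<lambda>e. \<forall>f\<in>set coarse_matching. disjnt e f) (received j)))"
      by (intro sum_mono) (auto simp: collected_def)
    also have "\<dots> = length coarse_matching + card residual"
      using k_pos by (simp add: sum.distrib sum_length_residual)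
    finally show ?thesis
      using assms(2) True by (meson le_trans mult_le_mono2)
  qed (simp add: collected_def)
qed (use edgeD set_collected_subset in auto)

lemma successful_run:
  assumes "real d \<le> \<rho>"
    and "\<And>j. j < k \<Longrightarrow> d * (length (received j) + (if j = 0 then 0 else length coarse_matching)) \<le> s"
    and "k * (d * length coarse_matching) \<le> s"
    and "d * (length coarse_matching + card residual) \<le> s"
  shows "successful \<rho> n k s E
    [traffic_of k collected, traffic_of k broadcast, traffic_of k scattered, initial_traffic k P]"
proof -
  have rec: "d * length (received j) \<le> s" if "j < k" for j
    using assms(2)[OF that] by (simp add: distrib_left)
  have "stores k (traffic_of k collected) 0 (set coarse_matching \<union> residual)"
    unfolding stores_def concat_inbox using k_pos set_stored by blast
  moreover have "set coarse_matching \<union> residual \<subseteq> E"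
    using coarse_matching_subset by (auto simp: residual_def)
  ultimately have "\<exists>H\<subseteq>E. stores k (traffic_of k collected) 0 H \<and> (\<exists>M\<subseteq>H. approx_matching \<rho> E M)"
    using stored_approximation[OF assms(1)] by blast
  then show ?thesis
    unfolding successful_def
    using within_limits_initial within_limits_scattered[OF rec]
      within_limits_broadcast[OF assms(2,3)] within_limits_collected[OF rec assms(4)]
    by auto
qed

end

section \<open>The two parameter regimes, and how the residual shows in the traffic\<close>

context filtering_run
begin

lemma successful_if_single_machine:
  assumes "real d \<le> \<rho>" and k: "k = 1" and s: "d * card E \<le> s"
  shows "successful \<rho> n k s E
    [traffic_of k collected, traffic_of k broadcast, traffic_of k scattered, initial_traffic k P]"
proof -
  have "size (mset (received 0)) = size (mset_set E)"
    unfolding mset_received[symmetric] using k by simp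
  then have "length (received 0) = card E" by simp
  moreover have "length coarse_matching \<le> card E"
    unfolding length_coarse_matching using finite_edges coarse_matching_subset by (rule card_mono)
  then have "d * length coarse_matching \<le> s"
    using s by (meson le_trans mult_le_mono2)
  moreover have "residual = {}"
    unfolding residual_eq using k by simp
  ultimately show ?thesis
    using assms by (intro successful_run) auto
qed

text \<open>The three bounds on \<open>s\<close> cover, in this order, the broadcast by machine 0, a
  received list together with the matching, and the final collection on machine 0.\<close>

lemma successful_if_small_residual:
  assumes "real d \<le> \<rho>" and "n * k \<le> s" "n + 2 * d * (card E div k + k) \<le> s"
    and "n + 2 * d * n * k \<le> s" and small: "card residual \<le> 2 * n * k"
  shows "successful \<rho> n k s E
    [traffic_of k collected, traffic_of k broadcast, traffic_of k scattered, initial_traffic k P]"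
proof (rule successful_run[OF assms(1)])
  have M: "d * length coarse_matching \<le> n" by (rule length_coarse_matching_le)
  show "d * (length (received j) + (if j = 0 then 0 else length coarse_matching)) \<le> s" for j
  proof -
    have "d * length (received j) \<le> d * (2 * (card E div k + k))"
      using length_received_le by (rule mult_le_mono2)
    also have "\<dots> + n \<le> s" using assms(3) by (simp add: mult_ac)
    finally have "d * length (received j) + n \<le> s" by simp
    then show ?thesis using M by (cases "j = 0") (simp_all add: distrib_left)
  qed
  show "k * (d * length coarse_matching) \<le> s"
    using le_trans[OF mult_le_mono2[OF M] assms(2)[unfolded mult.commute[of n]]] .
  show "d * (length coarse_matching + card residual) \<le> s"
  proof -
    have "d * card residual \<le> d * (2 * n * k)" using small by (rule mult_le_mono2)
    also have "\<dots> + n \<le> s" using assms(4) by (simp add: mult_ac)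
    finally have "d * card residual + n \<le> s" by simp
    then show ?thesis using M by (simp add: distrib_left)
  qed
qed

lemma coarse_vertices_subset: "\<Union>(set coarse_matching) \<subseteq> {..<n}"
  using coarse_matching_subset edgeD by blast

lemma residual_eq_avoiding: "residual = {e \<in> E. disjnt e (\<Union>(set coarse_matching))}"
  by (auto simp: residual_def disjnt_iff)

text \<open>Whatever machine 0 receives meets the coarse matching. The statement speaks of decoded
  messages so that the event can be read off the traffic without knowing \<open>X\<close>.\<close>

lemma scattered_avoids_residual:
  assumes "i < k"
  shows "set (decode_edges d (traffic_of k scattered i 0)) \<inter> residual = {}"
proof -
  have "decode_edges d (traffic_of k scattered i 0) = scattered i 0"
    using assms set_scattered_subset[OF assms] by (rule decode_message)
  moreover have "set (scattered i 0) \<subseteq> set (received 0)"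
    using assms by (auto simp: received_def)
  ultimately show ?thesis
    using maximal_coarse_matching by (auto simp: maximal_matching_def residual_def)
qed

lemma mpc_run_after_round_0:
  "bind_pmf (mpc_round k (filtering_protocol d k) 1 (traffic_of k scattered))
     (\<lambda>T\<^sub>2. map_pmf (\<lambda>T\<^sub>3. [T\<^sub>3, T\<^sub>2, traffic_of k scattered, initial_traffic k P])
        (mpc_round k (filtering_protocol d k) 2 T\<^sub>2)) =
   return_pmf [traffic_of k collected, traffic_of k broadcast, traffic_of k scattered,
     initial_traffic k P]"
  by (simp only: round_1 bind_return_pmf round_2 map_return_pmf)

end

section \<open>Success probability\<close>

text \<open>Failure can only come from \<open>B\<close>, since outside it the continuation lies in
  \<open>S\<close> with certainty.\<close>

lemma prob_bind_pmf_ge: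
  assumes "\<And>x. x \<in> set_pmf p \<Longrightarrow> x \<notin> B \<Longrightarrow> set_pmf (f x) \<subseteq> S"
  shows "measure_pmf.prob (bind_pmf p f) S \<ge> 1 - measure_pmf.prob p B"
proof -
  have "emeasure (bind_pmf p f) (- S) = (\<integral>\<^sup>+x. emeasure (f x) (- S) \<partial>p)"
    by simp
  also have "\<dots> \<le> (\<integral>\<^sup>+x. indicator B x \<partial>p)"
  proof (intro nn_integral_mono_AE AE_pmfI)
    fix x assume x: "x \<in> set_pmf p"
    show "emeasure (f x) (- S) \<le> indicator B x"
    proof (cases "x \<in> B")
      case False
      then have "measure_pmf.prob (f x) (- S) = 0"
        using assms[OF x] by (auto simp: measure_pmf_zero_iff)
      then show ?thesis by (simp add: measure_pmf.emeasure_eq_measure)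
    qed (simp add: measure_pmf.emeasure_le_1)
  qed
  finally have "measure_pmf.prob (bind_pmf p f) (- S) \<le> measure_pmf.prob p B"
    by (simp add: measure_pmf.emeasure_eq_measure)
  moreover have "measure_pmf.prob (bind_pmf p f) (- S) = 1 - measure_pmf.prob (bind_pmf p f) S"
    using measure_pmf.prob_compl[of S "bind_pmf p f"] by (simp add: Compl_eq_Diff_UNIV)
  ultimately show ?thesis by simp
qed

context filtering_instance
begin

definition scatter_pmf :: "nat \<Rightarrow> (nat \<Rightarrow> word_list) pmf" where
  "scatter_pmf i = map_pmf (\<lambda>xs j. encode_edges (scatter k (P i) (set xs) j))
     (replicate_pmf (length (P i) div k + 1) (pmf_of_set (set (P i))))"

lemma round_0:
  "mpc_round k (filtering_protocol d k) 0 (initial_traffic k P) = Pi_pmf {..<k} (\<lambda>_. []) scatter_pmf"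
  unfolding mpc_round_def
  by (intro Pi_pmf_cong) (auto simp: filtering_protocol_def decode_initial scatter_pmf_def Let_def)

text \<open>Every possible outcome of round 0 comes from some family of samples, so the
  deterministic analysis in \<open>filtering_run\<close> applies to it.\<close>

lemma set_pmf_round_0:
  assumes "T \<in> set_pmf (mpc_round k (filtering_protocol d k) 0 (initial_traffic k P))"
  shows "\<exists>X. filtering_run d n k s E P X \<and> T = traffic_of k (filtering_run.scattered k P X)"
proof -
  have T: "T \<in> PiE_dflt {..<k} (\<lambda>_. []) (set_pmf \<circ> scatter_pmf)"
    using assms by (simp add: round_0 set_Pi_pmf)
  have "\<exists>xs. length xs = length (P i) div k + 1 \<and>
      T i = (\<lambda>j. encode_edges (scatter k (P i) (set xs) j))" if "i < k" for i
  proof -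
    have "T i \<in> set_pmf (scatter_pmf i)"
      using T that by (simp add: PiE_dflt_def)
    then obtain xs where "T i = (\<lambda>j. encode_edges (scatter k (P i) (set xs) j))"
      and "xs \<in> set_pmf (replicate_pmf (length (P i) div k + 1) (pmf_of_set (set (P i))))"
      unfolding scatter_pmf_def set_map_pmf by (rule imageE)
    then show ?thesis
      unfolding set_replicate_pmf by (intro exI[of _ xs] conjI) simp_all
  qed
  then obtain g where g: "\<And>i. i < k \<Longrightarrow> length (g i) = length (P i) div k + 1"
    "\<And>i. i < k \<Longrightarrow> T i = (\<lambda>j. encode_edges (scatter k (P i) (set (g i)) j))"
    by metis
  have run: "filtering_run d n k s E P (\<lambda>i. set (g i))"
  proof
    show "\<exists>xs. set (g i) = set xs \<and> length xs = length (P i) div k + 1" if "i < k" for i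
      using g(1)[OF that] by (intro exI[of _ "g i"] conjI refl)
  qed
  have "T i = traffic_of k (filtering_run.scattered k P (\<lambda>i. set (g i))) i" for i
  proof (cases "i < k")
    case True
    then show ?thesis
      by (simp add: g(2) traffic_of_def filtering_run.scattered_def[OF run])
  next
    case False
    then show ?thesis
      using T by (simp add: traffic_of_def PiE_dflt_def)
  qed
  then have "T = traffic_of k (filtering_run.scattered k P (\<lambda>i. set (g i)))"
    by (rule ext)
  then show ?thesis by (intro exI[of _ "\<lambda>i. set (g i)"] conjI run)
qed

text \<open>All drawn hyperedges held by machine \<open>i\<close> go to machine 0. So a message that
  avoids \<open>F\<close> stems from draws that avoid \<open>F \<inter> set (P i)\<close>.\<close>

lemma prob_scatter_avoid_le:
  assumes "i < k"
  shows "measure_pmf.prob (scatter_pmf i) {out. set (decode_edges d (out 0)) \<inter> F = {}}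
    \<le> exp (- (real (card (F \<inter> set (P i))) / real k))"
proof -
  have "set xs \<inter> (F \<inter> set (P i)) = {}"
    if "set (decode_edges d (encode_edges (scatter k (P i) (set xs) 0))) \<inter> F = {}" for xs
  proof -
    have "decode_edges d (encode_edges (scatter k (P i) (set xs) 0)) = scatter k (P i) (set xs) 0"
      using subsetD[OF set_P_subset[OF assms]] set_scatter_subset[of k "P i" "set xs" 0] edgeD finite_edge d_pos
      by (intro decode_encode_edges) blast+
    then show ?thesis
      using that by (auto simp: scatter_def)
  qed
  then have "measure_pmf.prob (scatter_pmf i) {out. set (decode_edges d (out 0)) \<inter> F = {}} \<le>
      measure_pmf.prob (replicate_pmf (length (P i) div k + 1) (pmf_of_set (set (P i))))
        {xs. set xs \<inter> (F \<inter> set (P i)) = {}}"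
    unfolding scatter_pmf_def measure_map_pmf by (intro measure_pmf.finite_measure_mono) auto
  also have "length (P i) = card (set (P i))"
    using distinct_P[OF assms] by (simp add: distinct_card)
  also have "measure_pmf.prob (replicate_pmf (card (set (P i)) div k + 1) (pmf_of_set (set (P i))))
      {xs. set xs \<inter> (F \<inter> set (P i)) = {}} \<le> exp (- (real (card (F \<inter> set (P i))) / real k))"
    using k_pos by (intro prob_sample_avoid_le) auto
  finally show ?thesis .
qed

lemma sum_card_Int_P:
  assumes "F \<subseteq> E"
  shows "(\<Sum>i<k. card (F \<inter> set (P i))) = card F"
proof -
  have "(\<Union>i<k. F \<inter> set (P i)) = F"
    using assms placement by (auto simp: placement_def)
  moreover have "card (\<Union>i\<in>{..<k}. F \<inter> set (P i)) = (\<Sum>i<k. card (F \<inter> set (P i)))"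
    using placement by (intro card_UN_disjoint) (auto simp: placement_def disjoint_family_on_def)
  ultimately show ?thesis by simp
qed

text \<open>The machines draw independently, so the probabilities multiply. The placement partitions
  \<open>F\<close>, so the exponents add up to \<open>card F / k\<close> however the hyperedges are
  distributed.\<close>

lemma prob_round_0_avoid_le:
  assumes "F \<subseteq> E"
  shows "measure_pmf.prob (mpc_round k (filtering_protocol d k) 0 (initial_traffic k P))
      {T. \<forall>i<k. set (decode_edges d (T i 0)) \<inter> F = {}} \<le> exp (- (real (card F) / real k))"
proof -
  have "{T :: traffic. \<forall>i<k. set (decode_edges d (T i 0)) \<inter> F = {}} =
      Pi {..<k} (\<lambda>_. {out. set (decode_edges d (out 0)) \<inter> F = {}})"
    by (auto simp: Pi_def)
  then have "measure_pmf.prob (mpc_round k (filtering_protocol d k) 0 (initial_traffic k P))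
      {T. \<forall>i<k. set (decode_edges d (T i 0)) \<inter> F = {}} =
      (\<Prod>i<k. measure_pmf.prob (scatter_pmf i) {out. set (decode_edges d (out 0)) \<inter> F = {}})"
    by (simp only: round_0 measure_Pi_pmf_Pi finite_lessThan)
  also have "\<dots> \<le> (\<Prod>i<k. exp (- (real (card (F \<inter> set (P i))) / real k)))"
    using prob_scatter_avoid_le by (intro prod_mono) auto
  also have "\<dots> = exp (- (real (\<Sum>i<k. card (F \<inter> set (P i))) / real k))"
    by (simp only: exp_sum[OF finite_lessThan, symmetric])
      (simp add: sum_negf sum_divide_distrib)
  finally show ?thesis
    by (simp only: sum_card_Int_P[OF assms])
qed

text \<open>The vertex set of the coarse matching depends on the samples, so the estimate for a
  fixed set does not apply to it directly. The bad event therefore admits every vertex set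
  \<open>W\<close>.\<close>

definition missing_residual :: "traffic set" where
  "missing_residual = {T. \<exists>W\<subseteq>{..<n}. 2 * n * k \<le> card {e \<in> E. disjnt e W} \<and>
     (\<forall>i<k. set (decode_edges d (T i 0)) \<inter> {e \<in> E. disjnt e W} = {})}"

text \<open>Union bound over at most \<open>2 ^ n\<close> vertex sets. The factor 2 in
  \<open>2 * n * k\<close> makes each event as unlikely as \<open>exp (- 2 * n)\<close>, and
  \<open>2 \<le> exp 1\<close> absorbs the number of sets.\<close>

lemma prob_missing_residual_le:
  "measure_pmf.prob (mpc_round k (filtering_protocol d k) 0 (initial_traffic k P)) missing_residual
    \<le> exp (- real n)"
proof -
  let ?p = "mpc_round k (filtering_protocol d k) 0 (initial_traffic k P)"
  let ?F = "\<lambda>W. {e \<in> E. disjnt e W}"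
  let ?Ws = "{W \<in> Pow {..<n}. 2 * n * k \<le> card (?F W)}"
  let ?B = "\<lambda>W. {T. \<forall>i<k. set (decode_edges d (T i 0)) \<inter> ?F W = {}}"
  have fin: "finite ?Ws" by simp
  have "missing_residual = (\<Union>W\<in>?Ws. ?B W)"
    unfolding missing_residual_def by blast
  then have "measure_pmf.prob ?p missing_residual \<le> (\<Sum>W\<in>?Ws. measure_pmf.prob ?p (?B W))"
    using fin by (auto intro!: measure_pmf.finite_measure_subadditive_finite)
  also have "\<dots> \<le> (\<Sum>W\<in>?Ws. exp (- (2 * real n)))"
  proof (intro sum_mono)
    fix W assume "W \<in> ?Ws"
    then have "real (2 * n * k) \<le> real (card (?F W))" by (simp only: of_nat_le_iff) simp
    then have "2 * real n \<le> real (card (?F W)) / real k"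
      using k_pos by (simp add: field_simps)
    then have "exp (- (real (card (?F W)) / real k)) \<le> exp (- (2 * real n))" by simp
    moreover have "measure_pmf.prob ?p (?B W) \<le> exp (- (real (card (?F W)) / real k))"
      by (rule prob_round_0_avoid_le) auto
    ultimately show "measure_pmf.prob ?p (?B W) \<le> exp (- (2 * real n))"
      by (rule order_trans[rotated])
  qed
  also have "\<dots> = real (card ?Ws) * exp (- (2 * real n))" by simp
  also have "\<dots> \<le> 2 ^ n * exp (- (2 * real n))"
  proof -
    have "card ?Ws \<le> card (Pow {..<n})" by (intro card_mono) auto
    also have "\<dots> = 2 ^ n" by (simp add: card_Pow)
    finally have "real (card ?Ws) \<le> real (2 ^ n)"
      by (simp only: of_nat_le_iff)
    then show ?thesis by (intro mult_right_mono) (simp_all only: of_nat_power of_nat_numeral exp_ge_zero)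
  qed
  also have "\<dots> \<le> exp (real n) * exp (- (2 * real n))"
  proof -
    have "(2 :: real) ^ n \<le> exp 1 ^ n"
      using exp_ge_add_one_self[of 1] by (intro power_mono) auto
    then have "(2 :: real) ^ n \<le> exp (real n)"
      using exp_of_nat_mult[of n "1 :: real"] by simp
    then show ?thesis by (intro mult_right_mono) simp_all
  qed
  also have "\<dots> = exp (- real n)" by (simp flip: exp_add)
  finally show ?thesis .
qed

lemma prob_successful_ge:
  assumes \<rho>: "real d \<le> \<rho>"
    and param: "k = 1 \<and> d * card E \<le> s \<or>
      n * k \<le> s \<and> n + 2 * d * (card E div k + k) \<le> s \<and> n + 2 * d * n * k \<le> s"
  shows "measure_pmf.prob (mpc_run k (filtering_protocol d k) (initial_traffic k P) 3)
    {Ts. successful \<rho> n k s E Ts} \<ge> 1 - exp (- real n)"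
proof -
  let ?A = "filtering_protocol d k" and ?T\<^sub>0 = "initial_traffic k P"
  let ?f = "\<lambda>T\<^sub>1. bind_pmf (mpc_round k ?A 1 T\<^sub>1)
    (\<lambda>T\<^sub>2. map_pmf (\<lambda>T\<^sub>3. [T\<^sub>3, T\<^sub>2, T\<^sub>1, ?T\<^sub>0]) (mpc_round k ?A 2 T\<^sub>2))"
  have "set_pmf (?f T) \<subseteq> {Ts. successful \<rho> n k s E Ts}"
    if T: "T \<in> set_pmf (mpc_round k ?A 0 ?T\<^sub>0)" "T \<notin> missing_residual" for T
  proof -
    obtain X where X: "filtering_run d n k s E P X" "T = traffic_of k (filtering_run.scattered k P X)"
      using set_pmf_round_0[OF T(1)] by blast
    interpret run: filtering_run d n k s E P X by (rule X(1))
    have T_eq: "T = traffic_of k run.scattered" by (rule X(2))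
    have "card run.residual \<le> 2 * n * k"
    proof (rule ccontr)
      assume large: "\<not> card run.residual \<le> 2 * n * k"
      \<comment> \<open>The vertices of the coarse matching witness the bad event: the hyperedges
        avoiding them are exactly the residual.\<close>
      define W where "W = \<Union>(set run.coarse_matching)"
      have W: "{e \<in> E. disjnt e W} = run.residual"
        by (simp only: W_def run.residual_eq_avoiding)
      have "W \<subseteq> {..<n}" unfolding W_def by (rule run.coarse_vertices_subset)
      moreover have "2 * n * k \<le> card {e \<in> E. disjnt e W}" unfolding W using large by simp
      moreover have "\<forall>i<k. set (decode_edges d (T i 0)) \<inter> {e \<in> E. disjnt e W} = {}"
        unfolding W T_eq using run.scattered_avoids_residual by blast
      ultimately have "T \<in> missing_residual"
        unfolding missing_residual_def by blast
      with T(2) show False by simp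
    qed
    then have "successful \<rho> n k s E
        [traffic_of k run.collected, traffic_of k run.broadcast, T, ?T\<^sub>0]"
      unfolding T_eq using param \<rho> run.successful_if_single_machine run.successful_if_small_residual
      by blast
    then show ?thesis
      unfolding T_eq run.mpc_run_after_round_0 by simp
  qed
  then have "1 - measure_pmf.prob (mpc_round k ?A 0 ?T\<^sub>0) missing_residual \<le>
      measure_pmf.prob (mpc_run k ?A ?T\<^sub>0 3) {Ts. successful \<rho> n k s E Ts}"
    unfolding mpc_run_3 by (rule prob_bind_pmf_ge)
  with prob_missing_residual_le show ?thesis by linarith
qed

end

section \<open>Parameters\<close>

text \<open>Each machine holds about \<open>m / k\<close> hyperedges, while the broadcast and the
  residual take about \<open>n * k\<close>; the two balance at \<open>k = sqrt (m / n)\<close>. The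
  maximum covers \<open>m < n\<close> and, since division by zero gives zero, also
  \<open>n = 0\<close>.\<close>

definition machines :: "nat \<Rightarrow> nat \<Rightarrow> nat" where
  "machines n m = max 1 (nat \<lfloor>sqrt (real m / real n)\<rfloor>)"

text \<open>
  For \<open>m < n\<close> a single machine holds the whole input, and a space of \<open>sqrt (n m)\<close> would already exceed
  the bound on the total space.
\<close>

definition machine_space :: "nat \<Rightarrow> nat \<Rightarrow> nat \<Rightarrow> nat" where
  "machine_space d n m = d * (if m < n then m else nat \<lceil>7 * sqrt (real n * real m)\<rceil>)"

lemma machines_pos: "machines n m > 0"
  by (simp add: machines_def)

lemma machines_eq_1:
  assumes "m < n \<or> n = 0"
  shows "machines n m = 1"
proof -
  have "sqrt (real m / real n) < 2"
  proof -
    have "real m / real n \<le> 1" using assms by auto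
    then have "sqrt (real m / real n) \<le> sqrt 1" by (rule real_sqrt_le_mono)
    then show ?thesis using real_sqrt_one by linarith
  qed
  then show ?thesis unfolding machines_def by linarith
qed

text \<open>Rounding down a number that is at least 1 loses at most a factor of 2.\<close>

lemma machines_bounds:
  assumes "1 \<le> n" "n \<le> m"
  shows "real (machines n m) \<le> sqrt (real m / real n)"
    and "sqrt (real m / real n) \<le> 2 * real (machines n m)"
proof -
  have "1 \<le> sqrt (real m / real n)" using assms by simp
  then have floor: "1 \<le> \<lfloor>sqrt (real m / real n)\<rfloor>" by linarith
  then have "machines n m = nat \<lfloor>sqrt (real m / real n)\<rfloor>"
    unfolding machines_def by linarith
  with floor have "real (machines n m) = of_int \<lfloor>sqrt (real m / real n)\<rfloor>" by simp
  with floor show "real (machines n m) \<le> sqrt (real m / real n)"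
    and "sqrt (real m / real n) \<le> 2 * real (machines n m)"
    by linarith+
qed

lemma machines_le_sqrt: "m \<ge> 1 \<Longrightarrow> real (machines n m) \<le> sqrt (real m)"
proof (cases "m < n \<or> n = 0")
  case False
  assume "m \<ge> 1"
  have "real (machines n m) \<le> sqrt (real m / real n)"
    using False by (intro machines_bounds) auto
  also have "\<dots> \<le> sqrt (real m)"
    using False by (simp add: field_simps)
  finally show ?thesis .
qed (simp add: machines_eq_1)

text \<open>Rounding up adds at most 1, which is at most \<open>sqrt (n * m)\<close> if
  \<open>1 \<le> n \<le> m\<close>; this turns 7 into 8. If \<open>m < n\<close>, then
  \<open>m\<close> itself is at most \<open>sqrt (n * m)\<close>.\<close>

lemma space_le: "real (machine_space d n m) \<le> 8 * real d * sqrt (real n * real m)"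
proof -
  let ?x = "sqrt (real n * real m)"
  have "real (if m < n then m else nat \<lceil>7 * ?x\<rceil>) \<le> 8 * ?x"
  proof (cases "m < n")
    case True
    then have "real m * real m \<le> real n * real m" by (intro mult_right_mono) auto
    then have "sqrt (real m * real m) \<le> ?x" by (rule real_sqrt_le_mono)
    then have "real m \<le> ?x" by simp
    moreover have "0 \<le> ?x" by simp
    ultimately show ?thesis using True by simp
  next
    case False
    show ?thesis
    proof (cases "n = 0")
      case n: False
      with False have "real 1 \<le> real (n * m)" by (simp only: of_nat_le_iff) simp
      then have "1 \<le> ?x" by simp
      moreover have "real (nat \<lceil>7 * ?x\<rceil>) \<le> 7 * ?x + 1"
        using \<open>1 \<le> ?x\<close> by linarith
      ultimately have "real (nat \<lceil>7 * ?x\<rceil>) \<le> 8 * ?x" by linarith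
      then show ?thesis by (simp only: False if_False)
    qed simp
  qed
  then have "real d * real (if m < n then m else nat \<lceil>7 * ?x\<rceil>) \<le> real d * (8 * ?x)"
    by (rule mult_left_mono) simp
  then show ?thesis by (simp only: machine_space_def of_nat_mult mult_ac)
qed

lemma machines_mult_space_le: "real (machines n m) * real (machine_space d n m) \<le> 8 * real (d * m)"
proof (cases "m < n \<or> n = 0")
  case True
  then have "machine_space d n m \<le> d * m" by (auto simp: machine_space_def)
  then have "real (machine_space d n m) \<le> real (d * m)" by (simp only: of_nat_le_iff)
  then show ?thesis using True by (simp add: machines_eq_1)
next
  case False
  then have "real (machines n m) * real (machine_space d n m) \<le>
      sqrt (real m / real n) * (8 * real d * sqrt (real n * real m))"
    using space_le by (intro mult_mono machines_bounds) auto
  also have "\<dots> = 8 * real d * (sqrt (real m / real n) * sqrt (real n * real m))"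
    by (simp only: mult_ac)
  also have "sqrt (real m / real n) * sqrt (real n * real m) = sqrt (real m * real m)"
    using False by (simp flip: real_sqrt_mult)
  finally show ?thesis by simp
qed

lemma soft_O_I:
  assumes "\<And>n m. f n m \<le> C * g n m"
  shows "f \<in> soft_O g"
  unfolding soft_O_def using assms by (intro CollectI exI[of _ C] exI[of _ "0 :: nat"]) simp

text \<open>A lower bound on \<open>g\<close> is all that is assumed, so that the same parameters
  serve both space allowances. The number of machines is at most the square root of the input size,
  and the space inherits its exponent from \<open>g\<close>.\<close>

lemma mpc_resources_filtering:
  assumes "d \<ge> 1" and g: "\<And>n m. sqrt (real n * real m) \<le> g n m"
  shows "mpc_resources d g machines (machine_space d)"
proof -
  have space_g: "real (machine_space d n m) \<le> 8 * real d * g n m" for n m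
    using space_le[of d n m] mult_left_mono[OF g[of n m], of "8 * real d"] by simp
  have "substantially_sublinear_on d (\<lambda>n m. True) machines"
    unfolding substantially_sublinear_on_def
  proof (rule exI[of _ "1 / 2"], rule conjI, simp, rule exI[of _ 1], intro allI impI)
    fix n m :: nat assume "m \<ge> 1"
    then have "real (machines n m) \<le> sqrt (real m)" by (rule machines_le_sqrt)
    also have "\<dots> \<le> sqrt (real (d * m))"
      using mult_le_mono1[OF assms(1), of m]
      by (intro real_sqrt_le_mono) (simp only: of_nat_le_iff mult_1)
    finally show "real (machines n m) \<le> 1 * real (input_size d m) powr (1 - 1 / 2)"
      by (simp add: input_size_def powr_half_sqrt)
  qed
  moreover have "substantially_sublinear_on d
      (\<lambda>n m. g n m \<le> real (input_size d m) powr (1 - \<epsilon>)) (machine_space d)" if "\<epsilon> > 0" for \<epsilon>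
    unfolding substantially_sublinear_on_def
  proof (rule exI[of _ \<epsilon>], rule conjI, rule that, rule exI[of _ "8 * real d"], intro allI impI)
    fix n m :: nat assume "g n m \<le> real (input_size d m) powr (1 - \<epsilon>)"
    then have "8 * real d * g n m \<le> 8 * real d * real (input_size d m) powr (1 - \<epsilon>)"
      by (intro mult_left_mono) auto
    with space_g[of n m]
    show "real (machine_space d n m) \<le> 8 * real d * real (input_size d m) powr (1 - \<epsilon>)" by linarith
  qed
  ultimately show ?thesis
    unfolding mpc_resources_def
    using soft_O_I[OF space_g] soft_O_I[of "\<lambda>n m. real (machines n m) * real (machine_space d n m)" 8]
      machines_mult_space_le
    by (auto simp: input_size_def)
qed

text \<open>With \<open>x = sqrt (n * m)\<close>, each of \<open>n\<close>, \<open>k\<close> and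
  \<open>n * k\<close> is at most \<open>x\<close>, and \<open>m div k\<close> is at most
  \<open>2 * x\<close>. The costliest estimate, for \<open>n + 2 * d * (m div k + k)\<close>, is
  \<open>7 * d * x\<close>, whence the constant in \<open>machine_space\<close>.\<close>

lemma filtering_parameters:
  assumes "d \<ge> 1" and n: "1 \<le> n" and m: "n \<le> m"
  defines "k \<equiv> machines n m" and "s \<equiv> machine_space d n m"
  shows "n * k \<le> s" "n + 2 * d * (m div k + k) \<le> s" "n + 2 * d * n * k \<le> s"
    and "m \<le> k * (s div d)"
proof -
  define x where "x = sqrt (real n * real m)"
  define y where "y = sqrt (real m / real n)"
  define c where "c = nat \<lceil>7 * x\<rceil>"
  have s: "s = d * c" using m by (simp add: s_def machine_space_def c_def x_def)
  have c: "7 * x \<le> real c" unfolding c_def by linarith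
  have k: "real k \<le> y" "y \<le> 2 * real k" "k > 0"
    using machines_bounds[OF n m] machines_pos by (auto simp: k_def y_def)
  have xy: "x * y = real m" using n by (simp add: x_def y_def flip: real_sqrt_mult)
  have ny: "real n * y = x"
  proof -
    have "sqrt ((real n)\<^sup>2) * y = x"
      unfolding y_def x_def real_sqrt_mult[symmetric] using n by (simp add: power2_eq_square)
    then show ?thesis by simp
  qed
  have y1: "1 \<le> y" using n m by (simp add: y_def)
  have y0: "0 \<le> y" using y1 by simp
  have nx: "real n \<le> x" using ny mult_left_mono[OF y1, of "real n"] by simp
  have yx: "y \<le> x" using ny n mult_right_mono[of 1 "real n" y] y0 by simp
  have nk: "real n * real k \<le> x" using ny mult_left_mono[OF k(1), of "real n"] by simp
  have d: "1 \<le> real d" using assms(1) by simp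
  have x0: "0 \<le> x" by (simp add: x_def)
  have dx: "x \<le> real d * x" using mult_right_mono[OF d x0] by simp
  have dc: "7 * (real d * x) \<le> real s"
    using mult_left_mono[OF c, of "real d"] by (simp add: s mult_ac)
  have mk: "real (m div k) \<le> 2 * x"
  proof -
    have "real (m div k) * real k \<le> real m"
      by (simp only: of_nat_mult[symmetric] of_nat_le_iff div_times_less_eq_dividend)
    then have "real (m div k) \<le> real m / real k" using k by (simp add: pos_le_divide_eq)
    also have "\<dots> \<le> x * (2 * real k) / real k"
      unfolding xy[symmetric] using k x0 by (intro divide_right_mono mult_left_mono) auto
    also have "\<dots> = 2 * x" using k by simp
    finally show ?thesis .
  qed
  have "real (n * k) \<le> real s" using nk dx dc x0 by simp
  then show "n * k \<le> s" by (simp only: of_nat_le_iff)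
  have "real d * (real (m div k) + real k) \<le> real d * (3 * x)"
    using mk k yx by (intro mult_left_mono) auto
  then have "real (n + 2 * d * (m div k + k)) \<le> real s"
    using nx dx dc by simp
  then show "n + 2 * d * (m div k + k) \<le> s" by (simp only: of_nat_le_iff)
  have "real d * (real n * real k) \<le> real d * x" using nk by (intro mult_left_mono) auto
  then have "real (n + 2 * d * n * k) \<le> real s"
    using nx dx dc x0 by (simp add: mult_ac)
  then show "n + 2 * d * n * k \<le> s" by (simp only: of_nat_le_iff)
  have "real m \<le> x * (2 * real k)"
    unfolding xy[symmetric] using k x0 by (intro mult_left_mono) auto
  also have "\<dots> \<le> real k * (7 * x)" using x0 by (simp add: mult_ac)
  also have "\<dots> \<le> real k * real c" using c by (intro mult_left_mono) auto
  finally have "m \<le> k * c" by (simp only: of_nat_mult[symmetric] of_nat_le_iff)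
  then show "m \<le> k * (s div d)" using assms(1) by (simp add: s)
qed

text \<open>Blocks of \<open>s div d\<close> hyperedges fit into \<open>s\<close> words, and by
  assumption \<open>k\<close> consecutive blocks exhaust \<open>E\<close>.\<close>

lemma placement_exists:
  assumes E: "uniform_hypergraph d {..<n} E" and m: "card E \<le> k * (s div d)"
  shows "\<exists>P. placement k s E P"
proof -
  have "E \<subseteq> Pow {..<n}" using E by (auto simp: uniform_hypergraph_def)
  then have "finite E" using finite_subset by blast
  then obtain es where es: "set es = E" "distinct es"
    using finite_distinct_list by blast
  then have len: "length es = card E" by (metis distinct_card)
  define P where "P i = chunk (s div d) i es" for i
  have concat_P: "concat (map P [0..<k]) = es"
    unfolding P_def concat_chunks using m len by simp
  have "distinct (P i)" for i
    using es by (simp add: P_def chunk_def)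
  moreover have "length (encode_edges (P i)) \<le> s" for i
  proof -
    have "set (P i) \<subseteq> E"
      using es by (auto simp: P_def chunk_def dest: in_set_takeD in_set_dropD)
    then have "length (encode_edges (P i)) = d * length (P i)"
      using E by (intro length_encode_edges) (auto simp: uniform_hypergraph_def)
    also have "\<dots> \<le> d * (s div d)"
      unfolding P_def by (intro mult_le_mono2 length_chunk_le)
    also have "\<dots> \<le> s" by simp
    finally show ?thesis .
  qed
  moreover have "disjoint_family_on (\<lambda>i. set (P i)) {..<k}"
  proof -
    have "set (P i) \<inter> set (P j) = {}" if "i < j" for i j
    proof -
      \<comment> \<open>Block \<open>i\<close> ends before block \<open>j\<close> starts, and a
        prefix of a distinct list is disjoint from the remaining suffix.\<close>
      have "(i + 1) * (s div d) \<le> j * (s div d)"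
        using that by (intro mult_right_mono) auto
      then have "s div d + i * (s div d) \<le> j * (s div d)" by simp
      then have "set (take (s div d) (drop (i * (s div d)) es)) \<subseteq> set (take (j * (s div d)) es)"
        unfolding take_drop by (rule order_trans[OF set_drop_subset set_take_subset_set_take])
      moreover have "set (take (j * (s div d)) es) \<inter> set (drop (j * (s div d)) es) = {}"
        using es by (intro set_take_disj_set_drop_if_distinct) auto
      ultimately show ?thesis
        unfolding P_def chunk_def using set_take_subset[of "s div d" "drop (j * (s div d)) es"] by blast
    qed
    then show ?thesis
      unfolding disjoint_family_on_def by (metis Int_commute linorder_neqE_nat)
  qed
  moreover have "(\<Union>i<k. set (P i)) = E"
    using arg_cong[OF concat_P, of set] es by (simp add: atLeast0LessThan)
  ultimately show ?thesis unfolding placement_def by blast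
qed

lemma succeeds_whp_filtering:
  assumes "d \<ge> 1" "real d \<le> \<rho>"
  shows "succeeds_whp 3 \<rho> (\<lambda>n. {E. uniform_hypergraph d {..<n} E}) machines (machine_space d)
    (\<lambda>n m k s. filtering_protocol d k)"
  unfolding succeeds_whp_def Let_def
proof (intro exI[of _ "\<lambda>n. exp (- real n)"] conjI allI ballI impI)
  show "(\<lambda>n. exp (- real n)) \<longlonglongrightarrow> 0"
    using LIMSEQ_realpow_zero[of "exp (- 1)"] by (simp flip: exp_of_nat_mult)
next
  fix n :: nat and E :: "nat set set"
  assume "E \<in> {E. uniform_hypergraph d {..<n} E}"
  then have E: "uniform_hypergraph d {..<n} E" by simp
  define k where "k = machines n (card E)"
  define s where "s = machine_space d n (card E)"
  have small: "k = 1 \<and> s = d * card E" if "card E < n \<or> n = 0"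
  proof -
    have "card E = 0" if "n = 0"
    proof -
      \<comment> \<open>Without vertices the only candidate is the empty hyperedge, which
        \<open>d \<ge> 1\<close> excludes.\<close>
      have "E = {}" using E assms(1) that by (fastforce simp: uniform_hypergraph_def)
      then show ?thesis by simp
    qed
    then show ?thesis
      using that by (auto simp: k_def s_def machines_eq_1 machine_space_def)
  qed
  have large: "n * k \<le> s \<and> n + 2 * d * (card E div k + k) \<le> s \<and> n + 2 * d * n * k \<le> s \<and>
      card E \<le> k * (s div d)" if "\<not> (card E < n \<or> n = 0)"
    unfolding k_def s_def using filtering_parameters[OF assms(1)] that by simp
  have "card E \<le> k * (s div d)"
    using small large assms(1) by (cases "card E < n \<or> n = 0") auto
  with E show "\<exists>P. placement k s E P" by (rule placement_exists)
  fix P assume "placement k s E P"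
  then interpret filtering_instance d n k s E P
    by unfold_locales (use E assms(1) machines_pos in \<open>simp_all add: k_def\<close>)
  show "measure_pmf.prob (mpc_run k (filtering_protocol d k) (initial_traffic k P) 3)
      {Ts. successful \<rho> n k s E Ts} \<ge> 1 - exp (- real n)"
    using assms(2) small large by (intro prob_successful_ge) auto
qed

theorem mainTheorem6:
  shows "\<exists>(A :: nat \<Rightarrow> nat \<Rightarrow> nat \<Rightarrow> nat \<Rightarrow> nat \<Rightarrow> protocol)
          (K\<^sub>l :: nat \<Rightarrow> nat \<Rightarrow> nat \<Rightarrow> nat) (S\<^sub>l :: nat \<Rightarrow> nat \<Rightarrow> nat \<Rightarrow> nat)
          (K\<^sub>g :: nat \<Rightarrow> nat \<Rightarrow> nat \<Rightarrow> nat) (S\<^sub>g :: nat \<Rightarrow> nat \<Rightarrow> nat \<Rightarrow> nat).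
    \<forall>d\<ge>1. let \<rho> = (real d - 1 + 1 / real d)\<^sup>2 in
      mpc_resources d (\<lambda>n m. sqrt (real n * real m)) (K\<^sub>l d) (S\<^sub>l d) \<and>
      succeeds_whp 3 \<rho> (\<lambda>n. {E. uniform_hypergraph d {..<n} E \<and> linear_hypergraph E})
        (K\<^sub>l d) (S\<^sub>l d) (A d) \<and>
      mpc_resources d (\<lambda>n m. real n * sqrt (real n * real m)) (K\<^sub>g d) (S\<^sub>g d) \<and>
      succeeds_whp 3 \<rho> (\<lambda>n. {E. uniform_hypergraph d {..<n} E})
        (K\<^sub>g d) (S\<^sub>g d) (A d)"
proof (intro exI allI impI)
  fix d :: nat assume d: "d \<ge> 1"
  let ?A = "\<lambda>d (n :: nat) (m :: nat) k (s :: nat). filtering_protocol d k"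
  let ?\<rho> = "(real d - 1 + 1 / real d)\<^sup>2"
  have general: "succeeds_whp 3 ?\<rho> (\<lambda>n. {E. uniform_hypergraph d {..<n} E}) machines (machine_space d) (?A d)"
    using d approximation_ratio_ge[OF d] by (rule succeeds_whp_filtering)
  \<comment> \<open>Linear hypergraphs form a subclass, and the space used in general already
    respects their smaller allowance.\<close>
  then have linear: "succeeds_whp 3 ?\<rho>
      (\<lambda>n. {E. uniform_hypergraph d {..<n} E \<and> linear_hypergraph E}) machines (machine_space d) (?A d)"
    unfolding succeeds_whp_def by blast
  have "sqrt (real n * real m) \<le> real n * sqrt (real n * real m)" for n m :: nat
  proof (cases "n = 0")
    case False
    then have "1 * sqrt (real n * real m) \<le> real n * sqrt (real n * real m)"
      by (intro mult_right_mono) auto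
    then show ?thesis by simp
  qed simp
  then show "let \<rho> = ?\<rho> in
      mpc_resources d (\<lambda>n m. sqrt (real n * real m)) ((\<lambda>_. machines) d) (machine_space d) \<and>
      succeeds_whp 3 \<rho> (\<lambda>n. {E. uniform_hypergraph d {..<n} E \<and> linear_hypergraph E})
        ((\<lambda>_. machines) d) (machine_space d) (?A d) \<and>
      mpc_resources d (\<lambda>n m. real n * sqrt (real n * real m)) ((\<lambda>_. machines) d) (machine_space d) \<and>
      succeeds_whp 3 \<rho> (\<lambda>n. {E. uniform_hypergraph d {..<n} E})
        ((\<lambda>_. machines) d) (machine_space d) (?A d)"
    unfolding Let_def
    using general linear mpc_resources_filtering[OF d] by simp
qed

end
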